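(* Let $N\ge 5$ and $l>-2$, and suppose $1<p<\frac{N+2+2l}{N-2}$. If $u\in C^4(\mathbb{R}^N\setminus\{0\})\cap C^0(\mathbb{R}^N)$ with $|x|^2\Delta u\in C^0(\mathbb{R}^N)$ is a nonnegative solution of $$\Delta(|x|^2\Delta u)=|x|^l u^p\quad\text{in }\mathbb{R}^N,$$ then $u\equiv 0$ in $\mathbb{R}^N$.
   Context: A nonnegative solution of the equation in $\mathbb{R}^N$ means a function $u\ge 0$ with the stated regularity that satisfies the equation pointwise in $\mathbb{R}^N\setminus\{0\}$. The condition $|x|^2\Delta u\in C^0(\mathbb{R}^N)$ means that the function $|x|^2\Delta u$, defined on $\mathbb{R}^N\setminus\{0\}$, extends continuously to $\mathbb{R}^N$. (The exponent $\frac{N+2+2l}{N-2}$ is the value at $\alpha=2$ of $p_s=\frac{N'+4+2\tau}{N'-4}$, where $N'=N+\alpha$, $\tau=l-\alpha$.) *)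

theory Defs
  imports "HOL-Analysis.Analysis"
begin

definition partial_differentiable_at :: "'n \<Rightarrow> (real ^ 'n \<Rightarrow> real) \<Rightarrow> real ^ 'n \<Rightarrow> bool" where
  "partial_differentiable_at i f x \<longleftrightarrow>
     (\<lambda>t. f (x + t *\<^sub>R axis i 1)) differentiable (at 0)"

definition partial_deriv :: "'n \<Rightarrow> (real ^ 'n \<Rightarrow> real) \<Rightarrow> real ^ 'n \<Rightarrow> real" where
  "partial_deriv i f x = deriv (\<lambda>t. f (x + t *\<^sub>R axis i 1)) 0"

text \<open>The class \<open>C\<^sup>k(S)\<close>, meant for open \<open>S\<close>: all iterated partial derivatives of order at most
  \<open>k\<close> exist and are continuous on \<open>S\<close>. For open \<open>S\<close>, only the values of \<open>f\<close> on \<open>S\<close> matter.\<close>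

fun Ck_on :: "nat \<Rightarrow> (real ^ 'n) set \<Rightarrow> (real ^ 'n \<Rightarrow> real) \<Rightarrow> bool" where
  "Ck_on 0 S f \<longleftrightarrow> continuous_on S f"
| "Ck_on (Suc k) S f \<longleftrightarrow> continuous_on S f \<and>
     (\<forall>i. (\<forall>x\<in>S. partial_differentiable_at i f x) \<and> Ck_on k S (partial_deriv i f))"

definition laplacian :: "(real ^ 'n \<Rightarrow> real) \<Rightarrow> real ^ 'n \<Rightarrow> real" where
  "laplacian f x = (\<Sum>i\<in>UNIV. partial_deriv i (partial_deriv i f) x)"

definition extends_continuously :: "(real ^ 'n) set \<Rightarrow> (real ^ 'n \<Rightarrow> real) \<Rightarrow> bool" where
  "extends_continuously S f \<longleftrightarrow> (\<exists>g. continuous_on UNIV g \<and> (\<forall>x\<in>S. g x = f x))"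

text \<open>The value at \<open>0\<close> that the total function below happens to have is irrelevant: it is
  used only on the complement of \<open>0\<close>, where derivatives do not see it.\<close>

definition weighted_laplacian :: "(real ^ 'n \<Rightarrow> real) \<Rightarrow> real ^ 'n \<Rightarrow> real" where
  "weighted_laplacian u x = (norm x)\<^sup>2 * laplacian u x"

end

theory Submission
  imports Defs
begin

text \<open>
  Write \<open>N\<close> for the dimension, \<open>n = N - 2\<close> and \<open>t = ln \<bar>x\<bar>\<close>. On functions of \<open>t\<close> the operator
  \<open>\<bar>x\<bar>\<^sup>2 \<Delta>\<close> is \<open>\<partial>\<^sub>t\<^sup>2 + n \<partial>\<^sub>t\<close>, and conjugation with \<open>\<bar>x\<bar>\<^bsup>-n\<^esup> = exp (-n t)\<close> turns it into
  \<open>\<partial>\<^sub>t\<^sup>2 - n \<partial>\<^sub>t\<close>. Testing the equation with \<open>\<bar>x\<bar>\<^bsup>-n\<^esup> \<psi>(ln \<bar>x\<bar>)\<close>, where \<open>\<psi>\<close> has compact support, and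
  integrating by parts twice gives

    \<open>\<integral> \<bar>x\<bar>\<^bsup>l-n\<^esup> u\<^sup>p \<psi> dx = \<integral> \<bar>x\<bar>\<^bsup>-N\<^esup> u (\<psi>\<^bsup>(4)\<^esup> - 2n \<psi>\<^bsup>(3)\<^esup> + n\<^sup>2 \<psi>\<^bsup>(2)\<^esup>) dx\<close>

  (\<open>integral_laplacian_weighted_laplacian_log_radial\<close>). The test function vanishes near \<open>0\<close>, so
  the singularity there leaves no boundary terms.

  Take \<open>\<psi>(t) = b(t/S)\<close> with \<open>b(s) = (1 - s\<^sup>2)\<^sub>+\<^bsup>k+4\<^esup>\<close> and \<open>S\<close> large. There is no first-order term and
  no zeroth-order term on the right, so the bracket is \<open>O(S\<^bsup>-2\<^esup>)\<close> (\<open>dilated_cutoff_identity\<close>),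
  whereas the measure \<open>\<bar>x\<bar>\<^bsup>-N\<^esup> dx\<close> gives the region \<open>\<bar>t\<bar> \<le> S\<close> only a mass \<open>O(S)\<close>
  (\<open>log_shell_majorant\<close>). Where \<open>\<bar>x\<bar> \<le> 1\<close>, \<open>u\<close> is bounded and the right-hand side contributes
  \<open>O(1/S)\<close>. Where \<open>\<bar>x\<bar> \<ge> 1\<close>, nothing is known about the size of \<open>u\<close>, but \<open>\<bar>x\<bar>\<^bsup>l-n\<^esup> \<ge> \<bar>x\<bar>\<^bsup>-N\<^esup>\<close> because
  \<open>l > -2\<close>, and as \<open>p > 1\<close> Young's inequality absorbs the linear term into half of the left-hand
  side, again up to \<open>O(1/S)\<close> (\<open>absorb_into_power\<close>, \<open>absorbed_cutoff_estimate\<close>); for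
  this, \<open>k\<close> must be so large that the bracket, which vanishes to order \<open>k\<close> at the edge of the support,
  is bounded there by a multiple of \<open>\<psi>\<^bsup>1/p\<^esup>\<close>.

  Hence the left-hand side tends to \<open>0\<close> as \<open>S\<close> grows. But it is nonnegative and increases with
  \<open>S\<close>, so it is \<open>0\<close> for every \<open>S\<close>, and the continuous function \<open>u\<close> vanishes.
\<close>

section \<open>Integrals of derivatives and of nonnegative functions\<close>

text \<open>Translation invariance makes every difference quotient integrate to \<open>0\<close>; compact support and
  the mean value theorem give a common bounded majorant, so dominated convergence passes this on to
  the derivative.\<close>

lemma integral_directional_derivative_eq_0:
  fixes h h' :: "'a::euclidean_space \<Rightarrow> real"
  assumes der: "\<And>x. ((\<lambda>t. h (x + t *\<^sub>R e)) has_real_derivative h' x) (at 0)"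
    and cont: "continuous_on UNIV h" "continuous_on UNIV h'"
    and supp: "\<And>x. norm x > R \<Longrightarrow> h x = 0"
  shows "(\<integral>x. h' x \<partial>lborel) = 0"
proof -
  define s where "s k = inverse (real (Suc k))" for k
  have s: "0 < s k" "s k \<le> 1" for k
    by (auto simp: s_def divide_simps)
  define D where "D k x = (h (x + s k *\<^sub>R e) - h x) / s k" for k x
  have hint: "integrable lborel h"
  proof -
    have "integrable lborel (\<lambda>x. indicator (cball 0 R) x *\<^sub>R h x)"
      by (intro borel_integrable_compact continuous_on_subset[OF cont(1)]) auto
    moreover have "(\<lambda>x. indicator (cball 0 R) x *\<^sub>R h x) = h"
      using supp by (auto simp: indicator_def fun_eq_iff)
    ultimately show ?thesis by simp
  qed
  have D0: "(\<integral>x. D k x \<partial>lborel) = 0" for k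
  proof -
    have m: "(\<lambda>x. s k *\<^sub>R e + x) \<in> measurable lborel borel"
      by simp
    have hm: "h \<in> borel_measurable borel"
      using hint by (simp add: borel_measurable_integrable)
    have "integrable (distr lborel borel (\<lambda>x. s k *\<^sub>R e + x)) h"
      using hint by (simp add: lborel_distr_plus)
    hence i: "integrable lborel (\<lambda>x. h (s k *\<^sub>R e + x))"
      by (subst (asm) integrable_distr_eq[OF m hm])
    have "(\<integral>x. h (s k *\<^sub>R e + x) \<partial>lborel) = (\<integral>x. h x \<partial>distr lborel borel (\<lambda>x. s k *\<^sub>R e + x))"
      by (rule integral_distr[OF m hm, symmetric])
    also have "\<dots> = (\<integral>x. h x \<partial>lborel)"
      by (simp add: lborel_distr_plus)
    finally show ?thesis
      using i hint by (simp add: D_def add.commute)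
  qed
  have lim: "(\<lambda>k. D k x) \<longlonglongrightarrow> h' x" for x
  proof -
    have "((\<lambda>t. (h (x + t *\<^sub>R e) - h x) / t) \<longlongrightarrow> h' x) (at 0)"
      using der[of x] by (simp add: DERIV_def)
    moreover have "filterlim s (at 0) sequentially"
      unfolding s_def by (intro filterlim_atI LIMSEQ_inverse_real_of_nat) auto
    ultimately show ?thesis
      unfolding D_def by (rule filterlim_compose)
  qed
  have "bounded (h' ` cball 0 (R + 2 * norm e))"
    by (intro compact_imp_bounded compact_continuous_image continuous_on_subset[OF cont(2)]) auto
  then obtain M where M: "\<And>x. norm x \<le> R + 2 * norm e \<Longrightarrow> \<bar>h' x\<bar> \<le> M"
    by (fastforce simp: bounded_iff)
  have bound: "norm (D k x) \<le> \<bar>M\<bar> * indicator (cball 0 (R + norm e)) x" for k x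
  proof (cases "norm x \<le> R + norm e")
    case True
    have "((\<lambda>t. h (x + t *\<^sub>R e)) has_real_derivative h' (x + t *\<^sub>R e)) (at t)" for t
      using der[of "x + t *\<^sub>R e"] DERIV_shift[of "\<lambda>t. h (x + t *\<^sub>R e)" _ 0 t]
      by (simp add: algebra_simps)
    from MVT2[OF s(1)[of k], of "\<lambda>t. h (x + t *\<^sub>R e)", OF this]
    obtain z where z: "0 < z" "z < s k" "h (x + s k *\<^sub>R e) - h x = s k * h' (x + z *\<^sub>R e)"
      by auto
    have "norm (x + z *\<^sub>R e) \<le> norm x + norm (z *\<^sub>R e)"
      by (rule norm_triangle_ineq)
    also have "norm (z *\<^sub>R e) \<le> norm e"
      using z s(2)[of k] by (simp add: mult_left_le_one_le)
    finally have "\<bar>h' (x + z *\<^sub>R e)\<bar> \<le> M"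
      using True by (intro M) simp
    thus ?thesis
      using True z s(1)[of k] by (simp add: D_def)
  next
    case False
    have "norm x \<le> norm (x + s k *\<^sub>R e) + norm (s k *\<^sub>R e)"
      using norm_triangle_ineq4[of "x + s k *\<^sub>R e" "s k *\<^sub>R e"] by simp
    also have "norm (s k *\<^sub>R e) \<le> norm e"
      using s[of k] by (simp add: mult_left_le_one_le)
    finally have "h (x + s k *\<^sub>R e) = 0"
      using False by (intro supp) simp
    moreover have "h x = 0"
      using False by (intro supp) (smt (verit) norm_ge_zero)
    ultimately show ?thesis by (simp add: D_def)
  qed
  have "(\<lambda>k. \<integral>x. D k x \<partial>lborel) \<longlonglongrightarrow> (\<integral>x. h' x \<partial>lborel)"
  proof (rule integral_dominated_convergence)
    show "h' \<in> borel_measurable lborel"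
      using borel_measurable_continuous_onI[OF cont(2)] by simp
    have [measurable]: "h \<in> borel_measurable borel"
      by (rule borel_measurable_continuous_onI[OF cont(1)])
    show "D k \<in> borel_measurable lborel" for k
      unfolding D_def by measurable
    show "integrable lborel (\<lambda>x. \<bar>M\<bar> * indicator (cball 0 (R + norm e)) x)"
      by (intro integrable_mult_right integrable_real_indicator emeasure_bounded_finite) auto
  qed (use lim bound in auto)
  thus ?thesis
    by (simp add: D0 LIMSEQ_const_iff)
qed

lemma integral_0_imp_0_of_continuous_nonneg:
  fixes h :: "'a::euclidean_space \<Rightarrow> real"
  assumes cont: "continuous_on UNIV h" and nonneg: "\<And>x. 0 \<le> h x"
    and int: "integrable lborel h" and zero: "(\<integral>x. h x \<partial>lborel) = 0"
  shows "h x = 0"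
proof (rule ccontr)
  assume "h x \<noteq> 0"
  define U where "U = {y. h y \<noteq> 0}"
  have "open U"
    unfolding U_def using cont by (intro open_Collect_neq) auto
  have "AE y in lborel. h y = 0"
    using integral_nonneg_eq_0_iff_AE[OF int] nonneg zero by simp
  hence "U \<in> null_sets lborel"
    using \<open>open U\<close> by (subst AE_iff_null_sets) (auto simp: U_def)
  hence "negligible U"
    unfolding negligible_iff_null_sets by (rule null_sets_completionI)
  thus False
    using open_not_negligible[OF \<open>open U\<close>] \<open>h x \<noteq> 0\<close> by (auto simp: U_def)
qed

section \<open>Calculus of the classes \<open>C\<^sup>k\<close>\<close>

lemma eventually_line_in_open:
  fixes x e :: "'a::real_normed_vector"
  assumes "open S" "x \<in> S"
  shows "eventually (\<lambda>t. x + t *\<^sub>R e \<in> S) (nhds 0)"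
proof -
  have "open ((\<lambda>t. x + t *\<^sub>R e) -` S)"
    by (intro open_vimage assms continuous_intros)
  thus ?thesis
    using assms(2) by (auto simp: eventually_nhds)
qed

lemma DERIV_line_cong:
  fixes f g :: "'a::real_normed_vector \<Rightarrow> real"
  assumes "open S" "x \<in> S" "\<And>y. y \<in> S \<Longrightarrow> f y = g y"
  shows "((\<lambda>t. f (x + t *\<^sub>R e)) has_real_derivative d) (at 0) \<longleftrightarrow>
      ((\<lambda>t. g (x + t *\<^sub>R e)) has_real_derivative d) (at 0)"
proof (rule DERIV_cong_ev)
  show "eventually (\<lambda>t. f (x + t *\<^sub>R e) = g (x + t *\<^sub>R e)) (nhds 0)"
    using eventually_line_in_open[OF assms(1,2)] by eventually_elim (rule assms(3))
qed auto

lemma partial_cong: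
  assumes "open S" "\<And>x. x \<in> S \<Longrightarrow> f x = g x" "x \<in> S"
  shows "partial_differentiable_at i f x \<longleftrightarrow> partial_differentiable_at i g x"
    and "partial_deriv i f x = partial_deriv i g x"
proof -
  have D: "((\<lambda>t. f (x + t *\<^sub>R axis i 1)) has_real_derivative d) (at 0) \<longleftrightarrow>
      ((\<lambda>t. g (x + t *\<^sub>R axis i 1)) has_real_derivative d) (at 0)" for d
    by (rule DERIV_line_cong[OF assms(1,3)]) (rule assms(2))
  show "partial_differentiable_at i f x \<longleftrightarrow> partial_differentiable_at i g x"
    unfolding partial_differentiable_at_def real_differentiable_def D ..
  show "partial_deriv i f x = partial_deriv i g x"
    unfolding partial_deriv_def deriv_def D ..
qed

lemma Ck_on_cong:
  assumes "open S" "\<And>x. x \<in> S \<Longrightarrow> f x = g x"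
  shows "Ck_on k S f \<longleftrightarrow> Ck_on k S g"
  using assms(2)
proof (induction k arbitrary: f g)
  case 0
  thus ?case by (auto cong: continuous_on_cong)
next
  case (Suc k)
  note pc = partial_cong[OF assms(1) Suc.prems]
  have "Ck_on k S (partial_deriv i f) \<longleftrightarrow> Ck_on k S (partial_deriv i g)" for i
    by (intro Suc.IH pc)
  moreover have "continuous_on S f \<longleftrightarrow> continuous_on S g"
    using Suc.prems by (auto cong: continuous_on_cong)
  ultimately show ?case
    by (simp add: pc(1) cong: ball_cong)
qed

lemma Ck_on_imp_continuous_on: "Ck_on k S f \<Longrightarrow> continuous_on S f"
  by (cases k) auto

lemma Ck_on_SucD: "Ck_on (Suc k) S f \<Longrightarrow> Ck_on k S f"
  by (induction k arbitrary: f) (auto simp: Ck_on_imp_continuous_on)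

lemma has_partial_deriv:
  assumes "partial_differentiable_at i f x"
  shows "((\<lambda>t. f (x + t *\<^sub>R axis i 1)) has_real_derivative partial_deriv i f x) (at 0)"
  using assms unfolding partial_differentiable_at_def partial_deriv_def
  by (simp add: DERIV_deriv_iff_real_differentiable)

lemma partialI:
  assumes "((\<lambda>t. f (x + t *\<^sub>R axis i 1)) has_real_derivative d) (at 0)"
  shows "partial_differentiable_at i f x" "partial_deriv i f x = d"
  using assms unfolding partial_differentiable_at_def partial_deriv_def
  by (auto simp: real_differentiable_def DERIV_imp_deriv)

lemma Ck_on_SucI:
  assumes "open S" "continuous_on S f"
    and "\<And>i x. x \<in> S \<Longrightarrow> ((\<lambda>t. f (x + t *\<^sub>R axis i 1)) has_real_derivative d i x) (at 0)"
    and "\<And>i. Ck_on k S (d i)"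
  shows "Ck_on (Suc k) S f"
proof -
  have "Ck_on k S (partial_deriv i f)" for i
    using Ck_on_cong[OF assms(1), of "partial_deriv i f" "d i" k] partialI(2)[OF assms(3)] assms(4)
    by auto
  thus ?thesis
    using assms partialI(1)[OF assms(3)] by auto
qed

lemma Ck_on_const: "open S \<Longrightarrow> Ck_on k S (\<lambda>_. c)"
proof (induction k arbitrary: c)
  case (Suc k)
  show ?case
    by (rule Ck_on_SucI[where d = "\<lambda>_ _. 0"]) (use Suc in auto)
qed auto

lemma Ck_on_component:
  fixes S :: "(real ^ 'n) set"
  shows "open S \<Longrightarrow> Ck_on k S (\<lambda>x. x $ j)"
proof (cases k)
  case (Suc m)
  assume S: "open S"
  have "((\<lambda>t. (x + t *\<^sub>R axis i 1) $ j) has_real_derivative (if i = j then 1 else 0)) (at 0)" for i and x :: "real^'n"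
    by (auto simp: axis_def intro!: derivative_eq_intros)
  thus ?thesis
    unfolding Suc using S Ck_on_const[OF S]
    by (intro Ck_on_SucI[where d = "\<lambda>i _. if i = j then 1 else 0"]) (auto intro!: continuous_intros)
qed (auto intro!: continuous_intros)

lemma Ck_on_add: "open S \<Longrightarrow> Ck_on k S f \<Longrightarrow> Ck_on k S g \<Longrightarrow> Ck_on k S (\<lambda>x. f x + g x)"
proof (induction k arbitrary: f g)
  case 0
  thus ?case by (simp add: continuous_on_add)
next
  case (Suc k)
  show ?case
  proof (rule Ck_on_SucI)
    show "continuous_on S (\<lambda>x. f x + g x)"
      using Suc.prems by (simp add: continuous_on_add)
    show "((\<lambda>t. f (x + t *\<^sub>R axis i 1) + g (x + t *\<^sub>R axis i 1)) has_real_derivative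
        partial_deriv i f x + partial_deriv i g x) (at 0)" if "x \<in> S" for i x
      using Suc.prems that by (intro DERIV_add has_partial_deriv) simp_all
    show "Ck_on k S (\<lambda>x. partial_deriv i f x + partial_deriv i g x)" for i
      using Suc.prems by (intro Suc.IH) simp_all
  qed (fact Suc.prems)
qed

lemma Ck_on_sum:
  assumes "open S" "\<And>j. j \<in> A \<Longrightarrow> Ck_on k S (f j)"
  shows "Ck_on k S (\<lambda>x. \<Sum>j\<in>A. f j x)"
  using assms(2)
proof (induction A rule: infinite_finite_induct)
  case (insert a A)
  thus ?case by (simp add: Ck_on_add[OF assms(1)])
qed (simp_all add: Ck_on_const[OF assms(1)])

lemma Ck_on_mult: "open S \<Longrightarrow> Ck_on k S f \<Longrightarrow> Ck_on k S g \<Longrightarrow> Ck_on k S (\<lambda>x. f x * g x)"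
proof (induction k arbitrary: f g)
  case 0
  thus ?case by (simp add: continuous_on_mult)
next
  case (Suc k)
  show ?case
  proof (rule Ck_on_SucI)
    show "continuous_on S (\<lambda>x. f x * g x)"
      using Suc.prems by (simp add: continuous_on_mult)
    show "((\<lambda>t. f (x + t *\<^sub>R axis i 1) * g (x + t *\<^sub>R axis i 1)) has_real_derivative
        partial_deriv i f x * g x + partial_deriv i g x * f x) (at 0)" if "x \<in> S" for i x
      using DERIV_mult[OF has_partial_deriv[of i f x] has_partial_deriv[of i g x]] Suc.prems that
      by simp
    have "Ck_on k S f" "Ck_on k S g" "Ck_on k S (partial_deriv i f)" "Ck_on k S (partial_deriv i g)" for i
      using Suc.prems(2,3) Ck_on_SucD by (blast, blast, simp_all)
    thus "Ck_on k S (\<lambda>x. partial_deriv i f x * g x + partial_deriv i g x * f x)" for i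
      using Suc.prems(1) by (intro Ck_on_add Suc.IH)
  qed (fact Suc.prems)
qed

lemma Ck_on_weighted_laplacian:
  assumes "open S" "Ck_on (Suc (Suc k)) S f"
  shows "Ck_on k S (weighted_laplacian f)"
proof -
  have "Ck_on k S (\<lambda>x. (\<Sum>j\<in>UNIV. x $ j * x $ j) * (\<Sum>i\<in>UNIV. partial_deriv i (partial_deriv i f) x))"
    using assms by (intro Ck_on_mult Ck_on_sum Ck_on_component) auto
  moreover have "(norm x)\<^sup>2 = (\<Sum>j\<in>UNIV. x $ j * x $ j)" for x :: "real^'a"
    by (simp add: power2_norm_eq_inner inner_vec_def)
  ultimately show ?thesis
    by (simp add: weighted_laplacian_def[abs_def] laplacian_def)
qed

section \<open>Radial test functions in logarithmic scale\<close>

text \<open>Profiles are functions of \<open>t = ln \<bar>x\<bar>\<close> because dilations of \<open>x\<close> become translations of \<open>t\<close>, so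
  that \<open>\<bar>x\<bar>\<^sup>2 \<Delta>\<close> has constant coefficients in \<open>t\<close>. The value \<open>0\<close> at the origin is the continuous
  extension for profiles of compact support; \<open>ln 0 = 0\<close> would give \<open>F 0\<close> instead.\<close>

definition log_radial :: "(real \<Rightarrow> real) \<Rightarrow> 'a::real_normed_vector \<Rightarrow> real" where
  "log_radial F x = (if x = 0 then 0 else F (ln (norm x)))"

lemma log_radial_0 [simp]: "log_radial F 0 = 0"
  by (simp add: log_radial_def)

lemma log_radial_eq_0:
  assumes supp: "\<And>t. \<bar>t\<bar> > A \<Longrightarrow> F t = 0"
    and x: "norm x < exp (- A) \<or> norm x > exp A"
  shows "log_radial F x = 0"
proof (cases "x = 0")
  case False
  have "ln (norm x) < - A \<or> ln (norm x) > A"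
    using x False by (metis exp_less_cancel_iff exp_ln zero_less_norm_iff)
  thus ?thesis
    using supp[of "ln (norm x)"] by (auto simp: log_radial_def)
qed simp

text \<open>A radial factor that vanishes near \<open>0\<close> removes any singularity of \<open>f\<close> at \<open>0\<close>.\<close>

lemma
  fixes f :: "'a::euclidean_space \<Rightarrow> real"
  assumes f: "continuous_on (UNIV - {0}) f" and F: "continuous_on UNIV F"
    and supp: "\<And>t. \<bar>t\<bar> > A \<Longrightarrow> F t = 0"
  shows continuous_on_mult_log_radial: "continuous_on UNIV (\<lambda>x. f x * log_radial F x)"
    and integrable_mult_log_radial: "integrable lborel (\<lambda>x. f x * log_radial F x)"
proof -
  let ?h = "\<lambda>x. f x * log_radial F x"
  have "continuous_on (UNIV - {0}) (\<lambda>x. f x * F (ln (norm x)))"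
    by (intro continuous_intros f continuous_on_compose2[OF F]) auto
  hence 1: "continuous_on (UNIV - {0}) ?h"
    by (rule continuous_on_eq) (auto simp: log_radial_def)
  have "continuous_on (ball 0 (exp (- A))) (\<lambda>_ :: 'a. 0 :: real)"
    by simp
  hence 2: "continuous_on (ball 0 (exp (- A))) ?h"
    by (rule continuous_on_eq) (simp add: log_radial_eq_0[OF supp])
  have "continuous_on ((UNIV - {0}) \<union> ball 0 (exp (- A))) ?h"
    using 1 2 by (intro continuous_on_open_Un) auto
  also have "(UNIV - {0}) \<union> ball (0::'a) (exp (- A)) = UNIV"
    by auto
  finally show cont: "continuous_on UNIV ?h" .
  have "integrable lborel (\<lambda>x. indicator (cball 0 (exp A)) x *\<^sub>R ?h x)"
    by (intro borel_integrable_compact continuous_on_subset[OF cont]) auto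
  moreover have "(\<lambda>x. indicator (cball 0 (exp A)) x *\<^sub>R ?h x) = ?h"
  proof
    show "indicator (cball 0 (exp A)) x *\<^sub>R ?h x = ?h x" for x
      using log_radial_eq_0[of A F x, OF supp] by (cases "norm x \<le> exp A") auto
  qed
  ultimately show "integrable lborel ?h" by simp
qed

lemma DERIV_ln_norm_line:
  fixes x e :: "'a::real_inner"
  assumes "x \<noteq> 0"
  shows "((\<lambda>t. ln (norm (x + t *\<^sub>R e))) has_real_derivative (x \<bullet> e) / (norm x)\<^sup>2) (at 0)"
proof -
  have pos: "x \<bullet> x > 0" using assms by simp
  have "((\<lambda>t. ln (x \<bullet> x + 2 * t * (x \<bullet> e) + t\<^sup>2 * (e \<bullet> e)) / 2) has_real_derivative
      (x \<bullet> e) / (x \<bullet> x)) (at 0)"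
    using pos by (auto intro!: derivative_eq_intros simp: divide_simps)
  moreover have "ln (norm (x + t *\<^sub>R e)) = ln (x \<bullet> x + 2 * t * (x \<bullet> e) + t\<^sup>2 * (e \<bullet> e)) / 2" for t
  proof -
    have "x \<bullet> x + 2 * t * (x \<bullet> e) + t\<^sup>2 * (e \<bullet> e) = (x + t *\<^sub>R e) \<bullet> (x + t *\<^sub>R e)"
      by (simp add: inner_add_left inner_add_right inner_commute power2_eq_square)
    thus ?thesis
      by (simp only:) (simp add: norm_eq_sqrt_inner ln_sqrt)
  qed
  ultimately show ?thesis
    by (simp only: power2_norm_eq_inner)
qed

lemma DERIV_log_radial:
  fixes x :: "real ^ 'n"
  assumes dF: "\<And>t. (F has_real_derivative F' t) (at t)" and "x \<noteq> 0"
  shows "((\<lambda>t. log_radial F (x + t *\<^sub>R axis i 1)) has_real_derivative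
            x $ i * log_radial (\<lambda>t. exp (- 2 * t) * F' t) x) (at 0)"
proof -
  have "((\<lambda>t. F (ln (norm (x + t *\<^sub>R axis i 1)))) has_real_derivative
      F' (ln (norm x)) * ((x \<bullet> axis i 1) / (norm x)\<^sup>2)) (at 0)"
    by (rule DERIV_chain2[OF _ DERIV_ln_norm_line[OF \<open>x \<noteq> 0\<close>]]) (simp add: dF)
  moreover have "((\<lambda>t. F (ln (norm (x + t *\<^sub>R axis i 1)))) has_real_derivative d) (at 0) \<longleftrightarrow>
      ((\<lambda>t. log_radial F (x + t *\<^sub>R axis i 1)) has_real_derivative d) (at 0)" for d
    by (rule DERIV_line_cong[of "UNIV - {0}"]) (use \<open>x \<noteq> 0\<close> in \<open>auto simp: log_radial_def\<close>)
  moreover have "exp (- 2 * ln (norm x)) = 1 / (norm x)\<^sup>2"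
    using \<open>x \<noteq> 0\<close> by (simp add: exp_minus exp_double inverse_eq_divide)
  ultimately show ?thesis
    using \<open>x \<noteq> 0\<close> by (simp add: log_radial_def inner_axis mult_ac)
qed

text \<open>Green's second identity. For fixed \<open>i\<close>, the field \<open>f \<partial>\<^sub>i g - g \<partial>\<^sub>i f\<close>, where \<open>g\<close> is the radial
  function of profile \<open>F\<close>, has \<open>i\<close>-th derivative \<open>f \<partial>\<^sub>i\<partial>\<^sub>i g - g \<partial>\<^sub>i\<partial>\<^sub>i f\<close>. It vanishes near the
  singular point \<open>0\<close> as well as near infinity, so each of these derivatives has integral \<open>0\<close>. The
  right-hand side contains the radial Laplacian, which in the variable \<open>t = ln \<bar>x\<bar>\<close> reads
  \<open>exp (-2t) (\<partial>\<^sub>t\<^sup>2 + (N - 2) \<partial>\<^sub>t)\<close>.\<close>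

lemma integral_laplacian_log_radial:
  fixes f :: "real ^ 'n \<Rightarrow> real"
  assumes f: "Ck_on 2 (UNIV - {0}) f"
    and dF: "\<And>t. (F has_real_derivative F' t) (at t)"
    and dF': "\<And>t. (F' has_real_derivative F'' t) (at t)"
    and cont: "continuous_on UNIV F''"
    and supp: "\<And>t. \<bar>t\<bar> > A \<Longrightarrow> F t = 0" "\<And>t. \<bar>t\<bar> > A \<Longrightarrow> F' t = 0" "\<And>t. \<bar>t\<bar> > A \<Longrightarrow> F'' t = 0"
  shows "(\<integral>x. laplacian f x * log_radial F x \<partial>lborel) =
         (\<integral>x. f x * log_radial (\<lambda>t. exp (- 2 * t) * (F'' t + (real CARD('n) - 2) * F' t)) x \<partial>lborel)"
proof -
  let ?U = "UNIV - {0 :: real ^ 'n}"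
  define G where "G = (\<lambda>t. exp (- 2 * t) * F' t)"
  define H where "H = (\<lambda>t. exp (- 4 * t) * (F'' t - 2 * F' t))"
  have cF: "continuous_on UNIV F" "continuous_on UNIV F'"
    using DERIV_continuous_on[OF dF] DERIV_continuous_on[OF dF'] by simp_all
  have cG: "continuous_on UNIV G" "continuous_on UNIV H"
    unfolding G_def H_def by (auto intro!: continuous_intros cF cont)
  have sG: "\<And>t. \<bar>t\<bar> > A \<Longrightarrow> G t = 0" "\<And>t. \<bar>t\<bar> > A \<Longrightarrow> H t = 0"
    using supp by (auto simp: G_def H_def)
  have dG: "(G has_real_derivative exp (- 2 * t) * (F'' t - 2 * F' t)) (at t)" for t
    unfolding G_def by (auto intro!: derivative_eq_intros dF' simp: algebra_simps)
  have H_eq: "(\<lambda>t. exp (- 2 * t) * (exp (- 2 * t) * (F'' t - 2 * F' t))) = H"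
    by (auto simp: H_def fun_eq_iff mult_exp_exp simp flip: mult.assoc)
  have f2: "Ck_on (Suc (Suc 0)) ?U f"
    using f by (simp add: numeral_2_eq_2)
  have cf: "continuous_on ?U f" "\<And>i. continuous_on ?U (partial_deriv i f)"
    "\<And>i. continuous_on ?U (partial_deriv i (partial_deriv i f))"
    using f2 by simp_all
  have df: "((\<lambda>t. f (x + t *\<^sub>R axis i 1)) has_real_derivative partial_deriv i f x) (at 0)"
     "((\<lambda>t. partial_deriv i f (x + t *\<^sub>R axis i 1)) has_real_derivative
         partial_deriv i (partial_deriv i f) x) (at 0)" if "x \<noteq> 0" for x i
    using f2 that by (auto intro!: has_partial_deriv)
  have cf': "continuous_on ?U (\<lambda>x. f x * x $ i)" "continuous_on ?U (\<lambda>x. f x * (x $ i)\<^sup>2)" for i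
    by (intro continuous_intros cf)+
  \<comment> \<open>\<open>x $ i * log_radial G x\<close> is the first and \<open>(x $ i)\<^sup>2 * log_radial H x + log_radial G x\<close> the second
     \<open>i\<close>-th derivative of \<open>log_radial F\<close>.\<close>
  define h where "h i x = (f x * x $ i) * log_radial G x - partial_deriv i f x * log_radial F x" for i x
  define h' where "h' i x = (f x * (x $ i)\<^sup>2) * log_radial H x + f x * log_radial G x
      - partial_deriv i (partial_deriv i f) x * log_radial F x" for i x
  have h0: "(\<integral>x. h' i x \<partial>lborel) = 0" for i
  proof (rule integral_directional_derivative_eq_0[where h = "h i" and e = "axis i 1" and R = "exp A"])
    show "continuous_on UNIV (h i)"
      unfolding h_def
      by (rule continuous_on_diff[OF
            continuous_on_mult_log_radial[OF cf'(1) cG(1) sG(1)]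
            continuous_on_mult_log_radial[OF cf(2) cF(1) supp(1)]])
    show "continuous_on UNIV (h' i)"
      unfolding h'_def
      by (rule continuous_on_diff[OF continuous_on_add[OF
            continuous_on_mult_log_radial[OF cf'(2) cG(2) sG(2)]
            continuous_on_mult_log_radial[OF cf(1) cG(1) sG(1)]]
            continuous_on_mult_log_radial[OF cf(3) cF(1) supp(1)]])
    show "h i x = 0" if "norm x > exp A" for x
      using that by (simp add: h_def log_radial_eq_0[OF sG(1)] log_radial_eq_0[OF supp(1)])
    show "((\<lambda>t. h i (x + t *\<^sub>R axis i 1)) has_real_derivative h' i x) (at 0)" for x
    proof (cases "x = 0")
      case False
      have dc: "((\<lambda>t. (x + t *\<^sub>R axis i 1) $ i) has_real_derivative 1) (at 0)"
        by (auto simp: axis_def intro!: derivative_eq_intros)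
      have dG': "((\<lambda>t. log_radial G (x + t *\<^sub>R axis i 1)) has_real_derivative x $ i * log_radial H x) (at 0)"
        using DERIV_log_radial[OF dG False] unfolding H_eq .
      have dF': "((\<lambda>t. log_radial F (x + t *\<^sub>R axis i 1)) has_real_derivative x $ i * log_radial G x) (at 0)"
        using DERIV_log_radial[OF dF False] unfolding G_def .
      show ?thesis
        unfolding h_def
        by (rule DERIV_cong[OF DERIV_diff[OF DERIV_mult[OF DERIV_mult[OF df(1)[OF False] dc] dG']
              DERIV_mult[OF df(2)[OF False] dF']]])
           (simp add: h'_def algebra_simps power2_eq_square)
    next
      case True
      have "((\<lambda>t. h i (x + t *\<^sub>R axis i 1)) has_real_derivative 0) (at 0) \<longleftrightarrow>
          ((\<lambda>t. (\<lambda>_. 0) (x + t *\<^sub>R axis i 1)) has_real_derivative 0) (at 0)"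
        by (rule DERIV_line_cong[of "ball 0 (exp (- A))"])
           (use True in \<open>auto simp: h_def log_radial_eq_0[OF sG(1)] log_radial_eq_0[OF supp(1)]\<close>)
      thus ?thesis
        using True by (simp add: h'_def)
    qed
  qed
  have ih: "integrable lborel (h' i)" for i
    unfolding h'_def
    by (intro Bochner_Integration.integrable_diff Bochner_Integration.integrable_add
        integrable_mult_log_radial[OF cf'(2) cG(2) sG(2)]
        integrable_mult_log_radial[OF cf(1) cG(1) sG(1)]
        integrable_mult_log_radial[OF cf(3) cF(1) supp(1)])
  let ?K = "\<lambda>t. exp (- 2 * t) * (F'' t + (real CARD('n) - 2) * F' t)"
  have sum_h': "(\<Sum>i\<in>UNIV. h' i x) = f x * log_radial ?K x - laplacian f x * log_radial F x" for x
  proof (cases "x = 0")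
    case False
    have nx: "(\<Sum>i\<in>UNIV. (x $ i)\<^sup>2) = exp (2 * ln (norm x))"
    proof -
      have "exp (2 * ln (norm x)) = (norm x)\<^sup>2"
        using False by (subst exp_double) simp
      also have "(norm x)\<^sup>2 = (\<Sum>i\<in>UNIV. (x $ i)\<^sup>2)"
        by (simp add: norm_vec_def L2_set_def sum_nonneg)
      finally show ?thesis ..
    qed
    have "(\<Sum>i\<in>UNIV. h' i x) = f x * ((\<Sum>i\<in>UNIV. (x $ i)\<^sup>2) * log_radial H x + real CARD('n) * log_radial G x)
        - laplacian f x * log_radial F x"
      by (simp add: h'_def laplacian_def sum.distrib sum_subtractf sum_distrib_left sum_distrib_right algebra_simps)
    also have "(\<Sum>i\<in>UNIV. (x $ i)\<^sup>2) * log_radial H x + real CARD('n) * log_radial G x = log_radial ?K x"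
      unfolding nx using False
      by (simp add: log_radial_def H_def G_def mult_exp_exp flip: mult.assoc) (simp add: algebra_simps)
    finally show ?thesis .
  qed (simp add: h'_def)
  have "0 = (\<Sum>i\<in>UNIV. \<integral>x. h' i x \<partial>lborel)"
    by (simp add: h0)
  also have "\<dots> = (\<integral>x. (\<Sum>i\<in>UNIV. h' i x) \<partial>lborel)"
    using ih by (intro Bochner_Integration.integral_sum[symmetric])
  also have "\<dots> = (\<integral>x. f x * log_radial ?K x - laplacian f x * log_radial F x \<partial>lborel)"
    by (simp add: sum_h')
  also have "\<dots> = (\<integral>x. f x * log_radial ?K x \<partial>lborel) - (\<integral>x. laplacian f x * log_radial F x \<partial>lborel)"
  proof (rule Bochner_Integration.integral_diff)
    have "continuous_on UNIV ?K"
      by (intro continuous_intros cF cont)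
    thus "integrable lborel (\<lambda>x. f x * log_radial ?K x)"
      by (rule integrable_mult_log_radial[OF cf(1), where A = A]) (simp add: supp)
    have "continuous_on ?U (laplacian f)"
      unfolding laplacian_def[abs_def] by (intro continuous_intros cf)
    thus "integrable lborel (\<lambda>x. laplacian f x * log_radial F x)"
      by (rule integrable_mult_log_radial[OF _ cF(1) supp(1)])
  qed
  finally show ?thesis by simp
qed

text \<open>Since \<open>exp (-n t) = \<bar>x\<bar>\<^bsup>2-N\<^esup>\<close> is harmonic off \<open>0\<close>, no term with \<open>\<psi>\<close> itself survives when the
  Laplacian falls on the product. The profile keeps its factor \<open>exp (-n t)\<close>, apart from the
  \<open>exp (-2t)\<close> that the weight \<open>\<bar>x\<bar>\<^sup>2\<close> cancels, so the identity can be iterated.\<close>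

lemma integral_laplacian_fundamental_log_radial:
  fixes f :: "real ^ 'n \<Rightarrow> real"
  defines "n \<equiv> real CARD('n) - 2"
  assumes f: "Ck_on 2 (UNIV - {0}) f"
    and d: "\<And>t. (\<psi> has_real_derivative \<psi>' t) (at t)" "\<And>t. (\<psi>' has_real_derivative \<psi>'' t) (at t)"
    and cont: "continuous_on UNIV \<psi>''"
    and supp: "\<And>t. \<bar>t\<bar> > A \<Longrightarrow> \<psi> t = 0" "\<And>t. \<bar>t\<bar> > A \<Longrightarrow> \<psi>' t = 0" "\<And>t. \<bar>t\<bar> > A \<Longrightarrow> \<psi>'' t = 0"
  shows "(\<integral>x. laplacian f x * log_radial (\<lambda>t. exp (- n * t) * \<psi> t) x \<partial>lborel) =
         (\<integral>x. f x * log_radial (\<lambda>t. exp (- 2 * t) * (exp (- n * t) * (\<psi>'' t - n * \<psi>' t))) x \<partial>lborel)"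
proof -
  have c: "continuous_on UNIV \<psi>" "continuous_on UNIV \<psi>'"
    using DERIV_continuous_on[OF d(1)] DERIV_continuous_on[OF d(2)] by simp_all
  have "(\<integral>x. laplacian f x * log_radial (\<lambda>t. exp (- n * t) * \<psi> t) x \<partial>lborel) =
     (\<integral>x. f x * log_radial (\<lambda>t. exp (- 2 * t) *
        (exp (- n * t) * (\<psi>'' t - 2 * n * \<psi>' t + n\<^sup>2 * \<psi> t)
          + (real CARD('n) - 2) * (exp (- n * t) * (\<psi>' t - n * \<psi> t)))) x \<partial>lborel)"
  proof (rule integral_laplacian_log_radial[where A = A, OF f])
    show "((\<lambda>t. exp (- n * t) * \<psi> t) has_real_derivative exp (- n * t) * (\<psi>' t - n * \<psi> t)) (at t)" for t
      by (auto intro!: derivative_eq_intros d simp: algebra_simps)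
    show "((\<lambda>t. exp (- n * t) * (\<psi>' t - n * \<psi> t)) has_real_derivative
        exp (- n * t) * (\<psi>'' t - 2 * n * \<psi>' t + n\<^sup>2 * \<psi> t)) (at t)" for t
      by (auto intro!: derivative_eq_intros d simp: algebra_simps power2_eq_square)
    show "continuous_on UNIV (\<lambda>t. exp (- n * t) * (\<psi>'' t - 2 * n * \<psi>' t + n\<^sup>2 * \<psi> t))"
      by (intro continuous_intros c cont)
  qed (simp_all add: supp)
  also have "(\<lambda>t. exp (- 2 * t) * (exp (- n * t) * (\<psi>'' t - 2 * n * \<psi>' t + n\<^sup>2 * \<psi> t)
          + (real CARD('n) - 2) * (exp (- n * t) * (\<psi>' t - n * \<psi> t)))) =
      (\<lambda>t. exp (- 2 * t) * (exp (- n * t) * (\<psi>'' t - n * \<psi>' t)))"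
    unfolding n_def[symmetric] by (simp add: fun_eq_iff algebra_simps power2_eq_square)
  finally show ?thesis .
qed

text \<open>On the factor \<open>\<psi>\<close>, testing against \<open>\<Delta>(\<bar>x\<bar>\<^sup>2 \<Delta>u)\<close> produces \<open>(\<partial>\<^sub>t\<^sup>2 - n \<partial>\<^sub>t)\<^sup>2\<close>: a combination of
  derivatives of order at least two. This is what makes wide cutoffs cheap.\<close>

lemma integral_laplacian_weighted_laplacian_log_radial:
  fixes u :: "real ^ 'n \<Rightarrow> real"
  defines "n \<equiv> real CARD('n) - 2"
  assumes u: "Ck_on 4 (UNIV - {0}) u"
    and d: "\<And>t. (\<psi> has_real_derivative \<psi>1 t) (at t)" "\<And>t. (\<psi>1 has_real_derivative \<psi>2 t) (at t)"
      "\<And>t. (\<psi>2 has_real_derivative \<psi>3 t) (at t)" "\<And>t. (\<psi>3 has_real_derivative \<psi>4 t) (at t)"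
    and cont: "continuous_on UNIV \<psi>4"
    and supp: "\<And>t. \<bar>t\<bar> > A \<Longrightarrow> \<psi> t = 0" "\<And>t. \<bar>t\<bar> > A \<Longrightarrow> \<psi>1 t = 0" "\<And>t. \<bar>t\<bar> > A \<Longrightarrow> \<psi>2 t = 0"
      "\<And>t. \<bar>t\<bar> > A \<Longrightarrow> \<psi>3 t = 0" "\<And>t. \<bar>t\<bar> > A \<Longrightarrow> \<psi>4 t = 0"
  shows "(\<integral>x. laplacian (weighted_laplacian u) x * log_radial (\<lambda>t. exp (- n * t) * \<psi> t) x \<partial>lborel) =
         (\<integral>x. u x * log_radial (\<lambda>t. exp (- real CARD('n) * t) *
            (\<psi>4 t - 2 * n * \<psi>3 t + n\<^sup>2 * \<psi>2 t)) x \<partial>lborel)"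
proof -
  have C4: "Ck_on (Suc (Suc 2)) (UNIV - {0}) u"
    using u by (simp add: eval_nat_numeral)
  have c: "continuous_on UNIV \<psi>2" "continuous_on UNIV \<psi>3"
    using DERIV_continuous_on[OF d(3)] DERIV_continuous_on[OF d(4)] by simp_all
  let ?\<psi> = "\<lambda>t. \<psi>2 t - n * \<psi>1 t"
  let ?\<psi>1 = "\<lambda>t. \<psi>3 t - n * \<psi>2 t"
  let ?\<psi>2 = "\<lambda>t. \<psi>4 t - n * \<psi>3 t"
  have "(\<integral>x. laplacian (weighted_laplacian u) x * log_radial (\<lambda>t. exp (- n * t) * \<psi> t) x \<partial>lborel) =
      (\<integral>x. weighted_laplacian u x * log_radial (\<lambda>t. exp (- 2 * t) * (exp (- n * t) * ?\<psi> t)) x \<partial>lborel)"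
    unfolding n_def
    by (rule integral_laplacian_fundamental_log_radial[OF Ck_on_weighted_laplacian[OF _ C4] d(1,2) c(1) supp(1-3)])
       (auto simp: open_delete)
  also have "\<dots> = (\<integral>x. laplacian u x * log_radial (\<lambda>t. exp (- n * t) * ?\<psi> t) x \<partial>lborel)"
  proof (intro Bochner_Integration.integral_cong refl)
    fix x
    show "weighted_laplacian u x * log_radial (\<lambda>t. exp (- 2 * t) * (exp (- n * t) * ?\<psi> t)) x =
        laplacian u x * log_radial (\<lambda>t. exp (- n * t) * ?\<psi> t) x"
    proof (cases "x = 0")
      case False
      have "(norm x)\<^sup>2 * exp (- 2 * ln (norm x)) = 1"
        using False by (simp add: exp_minus exp_double)
      thus ?thesis
        using False by (simp add: log_radial_def weighted_laplacian_def)
    qed simp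
  qed
  also have "\<dots> = (\<integral>x. u x * log_radial (\<lambda>t. exp (- 2 * t) * (exp (- n * t) * (?\<psi>2 t - n * ?\<psi>1 t))) x \<partial>lborel)"
    unfolding n_def
  proof (rule integral_laplacian_fundamental_log_radial[where A = A])
    show "Ck_on 2 (UNIV - {0}) u"
      by (rule Ck_on_SucD[OF Ck_on_SucD[OF C4]])
    show "continuous_on UNIV (\<lambda>t. \<psi>4 t - (real CARD('n) - 2) * \<psi>3 t)"
      by (intro continuous_intros c cont)
    show "((\<lambda>t. \<psi>2 t - (real CARD('n) - 2) * \<psi>1 t) has_real_derivative
        \<psi>3 t - (real CARD('n) - 2) * \<psi>2 t) (at t)" for t
      by (intro DERIV_diff DERIV_cmult d)
    show "((\<lambda>t. \<psi>3 t - (real CARD('n) - 2) * \<psi>2 t) has_real_derivative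
        \<psi>4 t - (real CARD('n) - 2) * \<psi>3 t) (at t)" for t
      by (intro DERIV_diff DERIV_cmult d)
  qed (simp_all add: supp)
  also have "(\<lambda>t. exp (- 2 * t) * (exp (- n * t) * (?\<psi>2 t - n * ?\<psi>1 t))) =
      (\<lambda>t. exp (- real CARD('n) * t) * (\<psi>4 t - 2 * n * \<psi>3 t + n\<^sup>2 * \<psi>2 t))"
  proof
    fix t
    have "exp (- 2 * t) * exp (- n * t) = exp (- real CARD('n) * t)"
      by (simp add: mult_exp_exp n_def algebra_simps)
    moreover have "?\<psi>2 t - n * ?\<psi>1 t = \<psi>4 t - 2 * n * \<psi>3 t + n\<^sup>2 * \<psi>2 t"
      by (simp add: algebra_simps power2_eq_square)
    ultimately show "exp (- 2 * t) * (exp (- n * t) * (?\<psi>2 t - n * ?\<psi>1 t)) =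
        exp (- real CARD('n) * t) * (\<psi>4 t - 2 * n * \<psi>3 t + n\<^sup>2 * \<psi>2 t)"
      by (simp only: mult.assoc[symmetric])
  qed
  finally show ?thesis .
qed

section \<open>Cutoff functions\<close>

lemma DERIV_pos_part_power:
  "((\<lambda>y :: real. max 0 y ^ Suc (Suc k)) has_real_derivative real (Suc (Suc k)) * max 0 y ^ Suc k) (at y)"
proof -
  consider "y > 0" | "y < 0" | "y = 0" by linarith
  thus ?thesis
  proof cases
    case 1
    have ev: "eventually (\<lambda>z. z ^ Suc (Suc k) = max 0 z ^ Suc (Suc k)) (nhds y)"
      using eventually_nhds_in_open[of "{0<..}" y] 1 by (auto elim!: eventually_mono)
    have "((\<lambda>y :: real. y ^ Suc (Suc k)) has_real_derivative real (Suc (Suc k)) * max 0 y ^ Suc k) (at y)"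
      using 1 DERIV_pow[of "Suc (Suc k)" y] by simp
    thus ?thesis
      by (subst (asm) DERIV_cong_ev[OF refl ev refl])
  next
    case 2
    have ev: "eventually (\<lambda>z. 0 = max 0 z ^ Suc (Suc k)) (nhds y)"
      using eventually_nhds_in_open[of "{..<0}" y] 2 by (auto elim!: eventually_mono)
    have "((\<lambda>y :: real. 0) has_real_derivative real (Suc (Suc k)) * max 0 y ^ Suc k) (at y)"
      using 2 by simp
    thus ?thesis
      by (subst (asm) DERIV_cong_ev[OF refl ev refl])
  next
    case 3
    have "((\<lambda>h :: real. max 0 h ^ Suc (Suc k) / h) \<longlongrightarrow> 0) (at 0)"
    proof (rule Lim_null_comparison)
      show "eventually (\<lambda>h :: real. norm (max 0 h ^ Suc (Suc k) / h) \<le> \<bar>h\<bar> ^ Suc k) (at 0)"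
      proof (intro always_eventually allI)
        fix h :: real
        show "norm (max 0 h ^ Suc (Suc k) / h) \<le> \<bar>h\<bar> ^ Suc k"
        proof (cases "h > 0")
          case False
          hence "norm (max 0 h ^ Suc (Suc k) / h) = 0"
            by (simp add: max_def)
          thus ?thesis
            by (metis abs_ge_zero zero_le_power)
        qed simp
      qed
      have "((\<lambda>h :: real. \<bar>h\<bar> ^ Suc k) \<longlongrightarrow> \<bar>0\<bar> ^ Suc k) (at 0)"
        by (intro tendsto_intros)
      thus "((\<lambda>h :: real. \<bar>h\<bar> ^ Suc k) \<longlongrightarrow> 0) (at 0)" by simp
    qed
    thus ?thesis
      using 3 by (simp add: DERIV_def)
  qed
qed

text \<open>A bump of finite smoothness is preferred to a smooth one: the loss under differentiation must be
  compared with powers of the bump itself, and each derivative of \<open>(1 - s\<^sup>2)\<^sub>+\<^sup>k\<close> lowers the exponent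
  by just one.\<close>

definition cutoff :: "nat \<Rightarrow> real \<Rightarrow> real" where
  "cutoff k s = max 0 (1 - s\<^sup>2) ^ k"

lemma cutoff_nonneg: "0 \<le> cutoff k s"
  by (simp add: cutoff_def)

lemma cutoff_antimono: "j \<le> k \<Longrightarrow> cutoff k s \<le> cutoff j s"
  unfolding cutoff_def by (intro power_decreasing) auto

lemma cutoff_eq_0: "\<bar>s\<bar> \<ge> 1 \<Longrightarrow> k > 0 \<Longrightarrow> cutoff k s = 0"
  by (simp add: cutoff_def abs_le_square_iff[of 1, simplified] max_def)

lemma continuous_on_cutoff: "continuous_on A (cutoff k)"
  unfolding cutoff_def by (intro continuous_intros)

text \<open>The functions \<open>q (1 - s\<^sup>2)\<^sub>+\<^sup>k\<close> with polynomial \<open>q\<close> are closed under differentiation, which spares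
  the explicit formulas for the higher derivatives.\<close>

lemma DERIV_poly_cutoff:
  "\<exists>r. \<forall>s. ((\<lambda>s. poly q s * cutoff (Suc (Suc k)) s) has_real_derivative poly r s * cutoff (Suc k) s) (at s)"
proof (intro exI allI)
  fix s :: real
  \<comment> \<open>\<open>(q g\<^bsup>k+2\<^esup>)' = (q' g + (k+2) q g') g\<^bsup>k+1\<^esup>\<close> for \<open>g = 1 - s\<^sup>2\<close>\<close>
  let ?r = "pderiv q * [:1, 0, -1:] - smult (2 * real (Suc (Suc k))) (q * [:0, 1:])"
  have "(cutoff (Suc (Suc k)) has_real_derivative real (Suc (Suc k)) * max 0 (1 - s\<^sup>2) ^ Suc k * (- 2 * s)) (at s)"
    unfolding cutoff_def
    by (rule DERIV_chain2[OF DERIV_pos_part_power]) (auto intro!: derivative_eq_intros)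
  hence "((\<lambda>s. poly q s * cutoff (Suc (Suc k)) s) has_real_derivative
      poly (pderiv q) s * cutoff (Suc (Suc k)) s
      + real (Suc (Suc k)) * max 0 (1 - s\<^sup>2) ^ Suc k * (- 2 * s) * poly q s) (at s)"
    by (intro DERIV_mult poly_DERIV)
  moreover
  have "max 0 (1 - s\<^sup>2) * cutoff (Suc k) s = (1 - s\<^sup>2) * cutoff (Suc k) s"
    by (simp add: cutoff_def max_def)
  hence step: "cutoff (Suc (Suc k)) s = (1 - s\<^sup>2) * cutoff (Suc k) s"
    by (simp add: cutoff_def)
  have "poly (pderiv q) s * cutoff (Suc (Suc k)) s
      + real (Suc (Suc k)) * max 0 (1 - s\<^sup>2) ^ Suc k * (- 2 * s) * poly q s = poly ?r s * cutoff (Suc k) s"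
    unfolding cutoff_def[symmetric] step by (simp add: algebra_simps power2_eq_square)
  ultimately show "((\<lambda>s. poly q s * cutoff (Suc (Suc k)) s) has_real_derivative poly ?r s * cutoff (Suc k) s) (at s)"
    by simp
qed

lemma poly_cutoff_bound:
  assumes "0 < k" "k \<le> j"
  shows "\<exists>C. \<forall>s. \<bar>poly q s * cutoff j s\<bar> \<le> C * cutoff k s"
proof -
  have "bounded (poly q ` {-1..1})"
    by (intro compact_imp_bounded compact_continuous_image continuous_intros) auto
  then obtain C where C: "\<And>s. \<bar>s\<bar> \<le> 1 \<Longrightarrow> \<bar>poly q s\<bar> \<le> C"
    by (fastforce simp: bounded_iff)
  have "\<bar>poly q s * cutoff j s\<bar> \<le> C * cutoff k s" for s
  proof (cases "\<bar>s\<bar> \<le> 1")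
    case True
    have "\<bar>poly q s\<bar> * cutoff j s \<le> C * cutoff k s"
      using C[OF True] C[of 0] cutoff_antimono[OF assms(2), of s] cutoff_nonneg[of j s]
      by (intro mult_mono) auto
    thus ?thesis by (simp add: abs_mult cutoff_nonneg)
  next
    case False
    thus ?thesis
      using assms by (simp add: cutoff_eq_0)
  qed
  thus ?thesis by blast
qed

lemma cutoff_derivatives:
  assumes "0 < k"
  obtains b1 b2 b3 b4 C where
    "\<And>s. (cutoff (k + 4) has_real_derivative b1 s) (at s)"
    "\<And>s. (b1 has_real_derivative b2 s) (at s)"
    "\<And>s. (b2 has_real_derivative b3 s) (at s)"
    "\<And>s. (b3 has_real_derivative b4 s) (at s)"
    "continuous_on UNIV b4" "C > 0"
    "\<And>s. \<bar>b1 s\<bar> \<le> C * cutoff k s" "\<And>s. \<bar>b2 s\<bar> \<le> C * cutoff k s"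
    "\<And>s. \<bar>b3 s\<bar> \<le> C * cutoff k s" "\<And>s. \<bar>b4 s\<bar> \<le> C * cutoff k s"
proof -
  obtain m where m: "k = Suc m"
    using assms gr0_conv_Suc by blast
  obtain q1 where q1: "\<And>s. ((\<lambda>s. poly 1 s * cutoff (k + 4) s) has_real_derivative poly q1 s * cutoff (k + 3) s) (at s)"
    using DERIV_poly_cutoff[of 1 "k + 2"] by (auto simp: eval_nat_numeral)
  obtain q2 where q2: "\<And>s. ((\<lambda>s. poly q1 s * cutoff (k + 3) s) has_real_derivative poly q2 s * cutoff (k + 2) s) (at s)"
    using DERIV_poly_cutoff[of q1 "k + 1"] by (auto simp: eval_nat_numeral)
  obtain q3 where q3: "\<And>s. ((\<lambda>s. poly q2 s * cutoff (k + 2) s) has_real_derivative poly q3 s * cutoff (k + 1) s) (at s)"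
    using DERIV_poly_cutoff[of q2 k] by (auto simp: eval_nat_numeral)
  obtain q4 where q4: "\<And>s. ((\<lambda>s. poly q3 s * cutoff (k + 1) s) has_real_derivative poly q4 s * cutoff k s) (at s)"
    using DERIV_poly_cutoff[of q3 m] by (auto simp: m)
  obtain C1 C2 C3 C4 where C:
    "\<And>s. \<bar>poly q1 s * cutoff (k + 3) s\<bar> \<le> C1 * cutoff k s" "\<And>s. \<bar>poly q2 s * cutoff (k + 2) s\<bar> \<le> C2 * cutoff k s"
    "\<And>s. \<bar>poly q3 s * cutoff (k + 1) s\<bar> \<le> C3 * cutoff k s" "\<And>s. \<bar>poly q4 s * cutoff k s\<bar> \<le> C4 * cutoff k s"
    using poly_cutoff_bound[OF assms, of "k + 3" q1] poly_cutoff_bound[OF assms, of "k + 2" q2]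
      poly_cutoff_bound[OF assms, of "k + 1" q3] poly_cutoff_bound[OF assms, of k q4] by auto
  define C where "C = 1 + \<bar>C1\<bar> + \<bar>C2\<bar> + \<bar>C3\<bar> + \<bar>C4\<bar>"
  have le: "C' * cutoff k s \<le> C * cutoff k s" if "C' \<in> {C1, C2, C3, C4}" for C' s
    using that by (intro mult_right_mono cutoff_nonneg) (auto simp: C_def)
  show thesis
  proof (rule that[OF _ q2 q3 q4])
    show "(cutoff (k + 4) has_real_derivative poly q1 s * cutoff (k + 3) s) (at s)" for s
      using q1[of s] by simp
    show "continuous_on UNIV (\<lambda>s. poly q4 s * cutoff k s)"
      by (intro continuous_intros continuous_on_cutoff)
    show "C > 0"
      by (simp add: C_def)
  qed (rule order.trans[OF C(1) le] order.trans[OF C(2) le] order.trans[OF C(3) le] order.trans[OF C(4) le]; simp)+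
qed

text \<open>The cutoff in \<open>ln \<bar>x\<bar>\<close> is dilated by \<open>S\<close>. As only derivatives of order two to four occur in
  \<open>M S\<close>, the error is \<open>O(S\<^bsup>-2\<^esup>)\<close>, which beats the mass \<open>O(S)\<close> of the region
  \<open>\<bar>ln \<bar>x\<bar>\<bar> \<le> S\<close>.\<close>

lemma dilated_cutoff_identity:
  fixes u :: "real ^ 'n \<Rightarrow> real"
  defines "n \<equiv> real CARD('n) - 2"
  assumes u: "Ck_on 4 (UNIV - {0}) u" and k: "0 < k"
  obtains K M where "K > 0"
    "\<And>S. S > 0 \<Longrightarrow> continuous_on UNIV (M S)"
    "\<And>S t. S > 0 \<Longrightarrow> \<bar>t\<bar> > S \<Longrightarrow> M S t = 0"
    "\<And>S t. S \<ge> 1 \<Longrightarrow> M S t \<le> K * cutoff k (t / S) / S\<^sup>2"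
    "\<And>S. S > 0 \<Longrightarrow>
      (\<integral>x. laplacian (weighted_laplacian u) x * log_radial (\<lambda>t. exp (- n * t) * cutoff (k + 4) (t / S)) x \<partial>lborel) =
      (\<integral>x. u x * log_radial (\<lambda>t. exp (- real CARD('n) * t) * M S t) x \<partial>lborel)"
proof -
  obtain b1 b2 b3 b4 C where
    b: "\<And>s. (cutoff (k + 4) has_real_derivative b1 s) (at s)"
    "\<And>s. (b1 has_real_derivative b2 s) (at s)"
    "\<And>s. (b2 has_real_derivative b3 s) (at s)"
    "\<And>s. (b3 has_real_derivative b4 s) (at s)"
    "continuous_on UNIV b4" and C: "C > 0"
    and b_le: "\<And>s. \<bar>b1 s\<bar> \<le> C * cutoff k s" "\<And>s. \<bar>b2 s\<bar> \<le> C * cutoff k s"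
    "\<And>s. \<bar>b3 s\<bar> \<le> C * cutoff k s" "\<And>s. \<bar>b4 s\<bar> \<le> C * cutoff k s"
    using cutoff_derivatives[OF k] by metis
  have b_0: "b1 s = 0" "b2 s = 0" "b3 s = 0" "b4 s = 0" if "\<bar>s\<bar> \<ge> 1" for s
    using b_le[of s] cutoff_eq_0[OF that k] by simp_all
  have cont_b: "continuous_on UNIV b1" "continuous_on UNIV b2" "continuous_on UNIV b3"
    using DERIV_continuous_on[OF b(2)] DERIV_continuous_on[OF b(3)] DERIV_continuous_on[OF b(4)] by simp_all

  define K where "K = C * (1 + 2 * \<bar>n\<bar> + n\<^sup>2)"
  have K: "0 < K" using C by (simp add: K_def add_pos_nonneg)
  define M where "M S t = b4 (t / S) / S ^ 4 - 2 * n * (b3 (t / S) / S ^ 3) + n\<^sup>2 * (b2 (t / S) / S\<^sup>2)" for S t :: real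
  have M_le: "\<bar>M S t\<bar> \<le> K * cutoff k (t / S) / S\<^sup>2" if "S \<ge> 1" for S t
  proof -
    have S: "S ^ 2 \<le> S ^ 3" "S ^ 2 \<le> S ^ 4" "0 < S"
      using that by (auto intro!: power_increasing)
    have "\<bar>b4 (t / S) / S ^ 4\<bar> \<le> C * cutoff k (t / S) / S\<^sup>2"
      using S b_le(4)[of "t / S"] by (simp add: abs_divide) (intro frac_le, auto)
    moreover have "\<bar>b3 (t / S) / S ^ 3\<bar> \<le> C * cutoff k (t / S) / S\<^sup>2"
      using S b_le(3)[of "t / S"] by (simp add: abs_divide) (intro frac_le, auto)
    hence "\<bar>2 * n * (b3 (t / S) / S ^ 3)\<bar> \<le> 2 * \<bar>n\<bar> * (C * cutoff k (t / S) / S\<^sup>2)"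
      unfolding abs_mult[of "2 * n"] by (intro mult_mono) auto
    moreover have "\<bar>b2 (t / S) / S ^ 2\<bar> \<le> C * cutoff k (t / S) / S\<^sup>2"
      using S b_le(2)[of "t / S"] by (simp add: abs_divide) (intro frac_le, auto)
    hence "\<bar>n\<^sup>2 * (b2 (t / S) / S ^ 2)\<bar> \<le> n\<^sup>2 * (C * cutoff k (t / S) / S\<^sup>2)"
      unfolding abs_mult[of "n\<^sup>2"] by (intro mult_mono) auto
    ultimately have "\<bar>M S t\<bar> \<le> C * cutoff k (t / S) / S\<^sup>2 + 2 * \<bar>n\<bar> * (C * cutoff k (t / S) / S\<^sup>2)
        + n\<^sup>2 * (C * cutoff k (t / S) / S\<^sup>2)"
      unfolding M_def by linarith
    thus ?thesis by (simp add: K_def algebra_simps add_divide_distrib)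
  qed

  have cont_div: "continuous_on UNIV (\<lambda>t. f (t / S))" if "S > 0" "continuous_on UNIV f" for S :: real and f :: "real \<Rightarrow> real"
    using that by (intro continuous_on_compose2[OF that(2)] continuous_intros) auto
  have z: "cutoff (k + 4) (t / S) = 0" "b1 (t / S) = 0" "b2 (t / S) = 0" "b3 (t / S) = 0" "b4 (t / S) = 0"
    if "S > 0" "\<bar>t\<bar> > S" for S t
    using b_0[of "t / S"] that by (simp_all add: abs_divide cutoff_eq_0)
  have dil: "((\<lambda>t. f (t / S) / c) has_real_derivative f' (t / S) / (c * S)) (at t)"
    if "S > 0" "\<And>s. (f has_real_derivative f' s) (at s)" for f f' :: "real \<Rightarrow> real" and S c t
  proof -
    have "((\<lambda>t. f (t / S)) has_real_derivative f' (t / S) * (1 / S)) (at t)"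
      by (rule DERIV_chain2[OF that(2)]) (use \<open>S > 0\<close> in \<open>auto intro!: derivative_eq_intros\<close>)
    from DERIV_cdivide[OF this, of c] show ?thesis by (simp add: mult.commute)
  qed
  show thesis
  proof (rule that[OF K _ _ order.trans[OF abs_ge_self M_le]])
    show "continuous_on UNIV (M S)" if "S > 0" for S
      unfolding M_def using that by (intro continuous_intros cont_div b(5) cont_b) auto
    show "M S t = 0" if "S > 0" "\<bar>t\<bar> > S" for S t
      using z[OF that] by (simp add: M_def)
    fix S :: real
    assume S: "S > 0"
    have d: "((\<lambda>t. cutoff (k + 4) (t / S)) has_real_derivative b1 (t / S) / S) (at t)"
       "((\<lambda>t. b1 (t / S) / S) has_real_derivative b2 (t / S) / S\<^sup>2) (at t)"
       "((\<lambda>t. b2 (t / S) / S\<^sup>2) has_real_derivative b3 (t / S) / S ^ 3) (at t)"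
       "((\<lambda>t. b3 (t / S) / S ^ 3) has_real_derivative b4 (t / S) / S ^ 4) (at t)" for t
      using dil[OF S b(1), of 1 t] dil[OF S b(2), of S t] dil[OF S b(3), of "S\<^sup>2" t] dil[OF S b(4), of "S ^ 3" t]
      by (simp_all add: eval_nat_numeral mult_ac)
    show "(\<integral>x. laplacian (weighted_laplacian u) x * log_radial (\<lambda>t. exp (- n * t) * cutoff (k + 4) (t / S)) x \<partial>lborel) =
      (\<integral>x. u x * log_radial (\<lambda>t. exp (- real CARD('n) * t) * M S t) x \<partial>lborel)"
      unfolding M_def n_def
    proof (rule integral_laplacian_weighted_laplacian_log_radial[OF u d, where A = S])
      show "continuous_on UNIV (\<lambda>t. b4 (t / S) / S ^ 4)"
        using S by (intro continuous_intros cont_div b(5)) auto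
    qed (simp_all add: z[OF S])
  qed
qed

section \<open>Estimates for the nonlinear term and for the scale-invariant measure\<close>

text \<open>Young's inequality with the cutoff taken along. If \<open>z = y g\<^sup>k\<close> exceeds the threshold
  \<open>Z = (2C)\<^bsup>1/(p-1)\<^esup>\<close>, then \<open>2C \<le> z\<^bsup>p-1\<^esup> \<le> y\<^bsup>p-1\<^esup> g\<^sup>4\<close>, so that \<open>C z\<close> is at most half of \<open>y\<^sup>p g\<^bsup>k+4\<^esup>\<close>;
  otherwise \<open>C z \<le> C Z\<close>. The condition \<open>4 \<le> k (p - 1)\<close> says that the four powers of \<open>g\<close> that
  differentiation costs can be paid by \<open>g\<^bsup>k(p-1)\<^esup>\<close>.\<close>

lemma absorb_into_power:
  fixes y g p C :: real
  assumes "0 \<le> y" "0 \<le> g" "g \<le> 1" "1 < p" "0 < C" "4 \<le> real k * (p - 1)"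
  shows "C * (y * g ^ k) \<le> y powr p * g ^ (k + 4) / 2 + C * (2 * C) powr (1 / (p - 1))"
proof (cases "y * g ^ k \<le> (2 * C) powr (1 / (p - 1))")
  case True
  have "0 \<le> y powr p * g ^ (k + 4) / 2"
    using assms by simp
  thus ?thesis
    using mult_left_mono[OF True, of C] assms(5) by linarith
next
  case False
  define Z where "Z = (2 * C) powr (1 / (p - 1))"
  have Z: "0 < Z" using assms by (simp add: Z_def)
  have less: "Z < y * g ^ k" using False by (simp add: Z_def)
  have g: "0 < g" and y: "0 < y"
    using less Z assms(1,2,4,6) by (smt (verit) mult_zero_left mult_zero_right zero_power mult_eq_0_iff of_nat_0 gr0I)+
  have "2 * C = Z powr (p - 1)"
    using assms by (simp add: Z_def powr_powr)
  also have "\<dots> \<le> (y * g ^ k) powr (p - 1)"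
    using less Z assms(4) by (intro powr_mono2) auto
  also have "\<dots> = y powr (p - 1) * g powr (real k * (p - 1))"
    using g y by (simp add: powr_mult powr_realpow[symmetric] powr_powr)
  also have "\<dots> \<le> y powr (p - 1) * g powr 4"
    using assms(3,6) g by (intro mult_left_mono powr_mono') auto
  also have "g powr 4 = g ^ 4"
    using g powr_realpow[of g 4] by simp
  finally have "2 * C * (y * g ^ k) \<le> y powr (p - 1) * g ^ 4 * (y * g ^ k)"
    using g y by (intro mult_right_mono) auto
  also have "\<dots> = (y powr (p - 1) * y powr 1) * g ^ (k + 4)"
    using y by (simp add: power_add)
  also have "y powr (p - 1) * y powr 1 = y powr p"
    by (simp only: powr_add[symmetric]) simp
  finally have "C * (y * g ^ k) \<le> y powr p * g ^ (k + 4) / 2"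
    by simp
  moreover have "0 \<le> C * (2 * C) powr (1 / (p - 1))"
    using assms(5) by simp
  ultimately show ?thesis by linarith
qed

text \<open>The two regimes of the final estimate, for \<open>y = u x\<close>, \<open>t = ln \<bar>x\<bar>\<close> and \<open>g\<close> the base of the cutoff:
  inside the unit ball \<open>u\<close> is bounded, and outside \<open>exp ((l + 2) t) \<ge> 1\<close>, which makes the nonlinear
  term strong enough to absorb the linear one.\<close>

lemma absorbed_cutoff_estimate:
  fixes y g p K B S t m l :: real
  assumes y: "0 \<le> y" "t \<le> 0 \<Longrightarrow> y \<le> B" and B: "0 \<le> B" and g: "0 \<le> g" "g \<le> 1" and p: "1 < p"
    and l: "- 2 \<le> l" and K: "0 < K" and k: "4 \<le> real k * (p - 1)" and S: "1 \<le> S"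
    and m: "m \<le> K * g ^ k / S\<^sup>2"
  shows "y * m \<le> exp ((l + 2) * t) * y powr p * g ^ (k + 4) / 2
            + (K * B + K * (2 * K) powr (1 / (p - 1))) / S\<^sup>2"
proof -
  define D where "D = K * B + K * (2 * K) powr (1 / (p - 1))"
  have nonneg: "0 \<le> exp ((l + 2) * t) * y powr p * g ^ (k + 4) / 2"
    using g by simp
  have "y * m \<le> y * (K * g ^ k / S\<^sup>2)"
    by (intro mult_left_mono m y)
  also have "\<dots> = K * (y * g ^ k) / S\<^sup>2"
    by simp
  also have "\<dots> \<le> exp ((l + 2) * t) * y powr p * g ^ (k + 4) / 2 + D / S\<^sup>2"
  proof (cases "t \<le> 0")
    case True
    have "y * g ^ k \<le> B * 1"
      using g y(2)[OF True] B y(1) by (intro mult_mono power_le_one) auto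
    hence "K * (y * g ^ k) \<le> K * B"
      using K by simp
    also have "\<dots> \<le> D"
      using K by (simp add: D_def)
    finally have "K * (y * g ^ k) / S\<^sup>2 \<le> D / S\<^sup>2"
      by (intro divide_right_mono) auto
    thus ?thesis using nonneg by linarith
  next
    case False
    have "K * (y * g ^ k) \<le> y powr p * g ^ (k + 4) / 2 + K * (2 * K) powr (1 / (p - 1))"
      by (rule absorb_into_power) (use y g p K k in auto)
    hence "K * (y * g ^ k) / S\<^sup>2 \<le> (y powr p * g ^ (k + 4) / 2 + K * (2 * K) powr (1 / (p - 1))) / S\<^sup>2"
      by (intro divide_right_mono) auto
    also have "\<dots> = (y powr p * g ^ (k + 4) / 2) / S\<^sup>2 + K * (2 * K) powr (1 / (p - 1)) / S\<^sup>2"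
      by (simp add: add_divide_distrib)
    also have "K * (2 * K) powr (1 / (p - 1)) / S\<^sup>2 \<le> D / S\<^sup>2"
      using K B by (intro divide_right_mono) (auto simp: D_def)
    also have "(y powr p * g ^ (k + 4) / 2) / S\<^sup>2 \<le> (y powr p * g ^ (k + 4) / 2) / 1"
      using S g by (intro divide_left_mono) auto
    also have "\<dots> = 1 * (y powr p * g ^ (k + 4) / 2)"
      by simp
    also have "\<dots> \<le> exp ((l + 2) * t) * (y powr p * g ^ (k + 4) / 2)"
      using False l g by (intro mult_right_mono) auto
    finally show ?thesis
      by simp
  qed
  finally show ?thesis unfolding D_def .
qed

text \<open>The measure \<open>\<bar>x\<bar>\<^bsup>-N\<^esup> dx\<close> is invariant under dilations, so each of the shells
  \<open>j \<le> ln \<bar>x\<bar> \<le> j + 1\<close> carries a mass bounded independently of \<open>j\<close>, and \<open>\<bar>ln \<bar>x\<bar>\<bar> \<le> S\<close> carries a mass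
  \<open>O(S)\<close>. Replacing each shell by the ball that contains it gives a majorant with an integral that
  needs no polar coordinates.\<close>

lemma log_shell_majorant:
  fixes S :: nat
  obtains \<Phi> :: "'a::euclidean_space \<Rightarrow> real" where
    "integrable lborel \<Phi>" "\<And>x. 0 \<le> \<Phi> x"
    "(\<integral>x. \<Phi> x \<partial>lborel) = (2 * real S + 1) * (exp (DIM('a)) * unit_ball_vol (DIM('a)))"
    "\<And>x. x \<noteq> 0 \<Longrightarrow> \<bar>ln (norm x)\<bar> \<le> real S \<Longrightarrow> exp (- real DIM('a) * ln (norm x)) \<le> \<Phi> x"
proof -
  let ?N = "real DIM('a)"
  define \<Phi> where "\<Phi> x = (\<Sum>j\<in>{- int S..int S}. exp (- ?N * real_of_int j) *
    indicator (cball 0 (exp (real_of_int j + 1))) x)" for x :: 'a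
  have int1: "integrable lborel (\<lambda>x :: 'a. exp (- ?N * real_of_int j) * indicator (cball 0 (exp (real_of_int j + 1))) x :: real)" for j
    by (intro integrable_mult_right integrable_real_indicator emeasure_bounded_finite) auto
  have val1: "(\<integral>x. exp (- ?N * real_of_int j) * indicator (cball (0 :: 'a) (exp (real_of_int j + 1))) x \<partial>lborel) =
      exp ?N * unit_ball_vol ?N" for j
  proof -
    have "(\<integral>x. exp (- ?N * real_of_int j) * indicator (cball (0 :: 'a) (exp (real_of_int j + 1))) x \<partial>lborel) =
        exp (- ?N * real_of_int j) * measure lborel (cball (0 :: 'a) (exp (real_of_int j + 1)))"
      by simp
    also have "\<dots> = exp (- ?N * real_of_int j) * (unit_ball_vol ?N * exp (real_of_int j + 1) ^ DIM('a))"
      using content_cball[of "exp (real_of_int j + 1)" "0 :: 'a"] by simp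
    also have "exp (real_of_int j + 1) ^ DIM('a) = exp (?N * (real_of_int j + 1))"
      by (simp add: exp_of_nat_mult)
    also have "exp (- ?N * real_of_int j) * (unit_ball_vol ?N * exp (?N * (real_of_int j + 1))) =
        unit_ball_vol ?N * (exp (- ?N * real_of_int j) * exp (?N * (real_of_int j + 1)))"
      by simp
    also have "exp (- ?N * real_of_int j) * exp (?N * (real_of_int j + 1)) = exp ?N"
      by (simp add: mult_exp_exp algebra_simps)
    finally show ?thesis by simp
  qed
  show thesis
  proof (rule that)
    show "integrable lborel \<Phi>"
      unfolding \<Phi>_def by (intro Bochner_Integration.integrable_sum int1)
    show "0 \<le> \<Phi> x" for x
      unfolding \<Phi>_def by (intro sum_nonneg) auto
    have "(\<integral>x. \<Phi> x \<partial>lborel) = (\<Sum>j\<in>{- int S..int S}. exp ?N * unit_ball_vol ?N)"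
      unfolding \<Phi>_def by (subst Bochner_Integration.integral_sum[OF int1]) (simp only: val1)
    also have "\<dots> = (2 * real S + 1) * (exp ?N * unit_ball_vol ?N)"
      by simp
    finally show "(\<integral>x. \<Phi> x \<partial>lborel) = (2 * real S + 1) * (exp ?N * unit_ball_vol ?N)" .
    fix x :: 'a
    assume x: "x \<noteq> 0" "\<bar>ln (norm x)\<bar> \<le> real S"
    define j where "j = \<lfloor>ln (norm x)\<rfloor>"
    have j: "real_of_int j \<le> ln (norm x)" "ln (norm x) \<le> real_of_int j + 1"
      unfolding j_def by linarith+
    have jS: "j \<in> {- int S..int S}"
      using x(2) unfolding j_def by (auto simp: abs_le_iff le_floor_iff floor_le_iff)
    have "norm x \<le> exp (real_of_int j + 1)"
      using j(2) x(1) by (metis exp_le_cancel_iff exp_ln zero_less_norm_iff)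
    hence "exp (- ?N * ln (norm x)) \<le> exp (- ?N * real_of_int j) * indicator (cball 0 (exp (real_of_int j + 1))) x"
      using j(1) by simp
    also have "\<dots> \<le> \<Phi> x"
      unfolding \<Phi>_def using jS by (intro member_le_sum) auto
    finally show "exp (- ?N * ln (norm x)) \<le> \<Phi> x" .
  qed
qed

section \<open>The Liouville theorem\<close>

theorem theorem1p3:
  fixes u :: "real ^ 'n \<Rightarrow> real" and l p :: real
  assumes "CARD('n) \<ge> 5"
    and "l > -2"
    and "1 < p" and "p < (real CARD('n) + 2 + 2 * l) / (real CARD('n) - 2)"
    and "Ck_on 4 (UNIV - {0}) u"
    and "continuous_on UNIV u"
    and "extends_continuously (UNIV - {0}) (weighted_laplacian u)"
    and "\<forall>x. u x \<ge> 0"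
    and "\<forall>x\<in>UNIV - {0}. laplacian (weighted_laplacian u) x = norm x powr l * u x powr p"
  shows "\<forall>x. u x = 0"
proof -
  let ?N = "real CARD('n)"
  define n where "n = ?N - 2"
  note cont_u = \<open>continuous_on UNIV u\<close>
  have u_nonneg: "0 \<le> u x" for x
    using assms(8) by blast
  \<comment> \<open>The exponent \<open>k + 4\<close> of the cutoff leaves at least \<open>k\<close> after four differentiations.\<close>
  obtain k :: nat where k: "0 < k" "4 \<le> real k * (p - 1)"
  proof -
    obtain m :: nat where m: "4 / (p - 1) < real m"
      using reals_Archimedean2 by blast
    show thesis
    proof (rule that[of "Suc m"])
      have "4 < real m * (p - 1)"
        using m \<open>1 < p\<close> by (simp add: divide_less_eq)
      thus "4 \<le> real (Suc m) * (p - 1)"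
        using \<open>1 < p\<close> by (simp add: algebra_simps)
    qed simp
  qed
  \<comment> \<open>Test with \<open>\<bar>x\<bar>\<^bsup>2-N\<^esup>\<close> times the cutoff of \<open>ln \<bar>x\<bar>\<close> at scale \<open>S\<close>; \<open>J S\<close> is the resulting weighted
     integral of \<open>u\<^sup>p\<close>.\<close>
  obtain K M where K: "K > 0"
    and cont_M: "\<And>S. S > 0 \<Longrightarrow> continuous_on UNIV (M S)"
    and M_0: "\<And>S t. S > 0 \<Longrightarrow> \<bar>t\<bar> > S \<Longrightarrow> M S t = 0"
    and M_le: "\<And>S t. S \<ge> 1 \<Longrightarrow> M S t \<le> K * cutoff k (t / S) / S\<^sup>2"
    and Green: "\<And>S. S > 0 \<Longrightarrow>
      (\<integral>x. laplacian (weighted_laplacian u) x * log_radial (\<lambda>t. exp (- n * t) * cutoff (k + 4) (t / S)) x \<partial>lborel) =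
      (\<integral>x. u x * log_radial (\<lambda>t. exp (- ?N * t) * M S t) x \<partial>lborel)"
  proof -
    show thesis
      by (rule dilated_cutoff_identity[OF assms(5) k(1), folded n_def]) (rule that)
  qed

  define \<psi> where "\<psi> S t = cutoff (k + 4) (t / S)" for S t :: real
  define J where "J S = (\<integral>x. u x powr p * log_radial (\<lambda>t. exp ((l - n) * t) * \<psi> S t) x \<partial>lborel)" for S
  have \<psi>_0: "\<psi> S t = 0" if "\<bar>t\<bar> > S" "S > 0" for S t
    unfolding \<psi>_def using that by (intro cutoff_eq_0) (auto simp: abs_divide)
  have cont_\<psi>: "continuous_on UNIV (\<psi> S)" if "S > 0" for S
    unfolding \<psi>_def using that
    by (intro continuous_on_compose2[OF continuous_on_cutoff[of UNIV]] continuous_intros) auto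
  have cont_up: "continuous_on (UNIV - {0}) (\<lambda>x. u x powr p)"
    using \<open>1 < p\<close> u_nonneg
    by (intro continuous_on_powr' continuous_on_const continuous_on_subset[OF cont_u]) auto
  have cont_J: "continuous_on UNIV (\<lambda>x. u x powr p * log_radial (\<lambda>t. exp ((l - n) * t) * \<psi> S t) x)"
   and int_J: "integrable lborel (\<lambda>x. u x powr p * log_radial (\<lambda>t. exp ((l - n) * t) * \<psi> S t) x)" if "S > 0" for S
  proof -
    have "continuous_on UNIV (\<lambda>t. exp ((l - n) * t) * \<psi> S t)"
      by (intro continuous_intros cont_\<psi> that)
    from continuous_on_mult_log_radial[OF cont_up this, of S] integrable_mult_log_radial[OF cont_up this, of S]
    show "continuous_on UNIV (\<lambda>x. u x powr p * log_radial (\<lambda>t. exp ((l - n) * t) * \<psi> S t) x)"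
      "integrable lborel (\<lambda>x. u x powr p * log_radial (\<lambda>t. exp ((l - n) * t) * \<psi> S t) x)"
      using \<psi>_0[OF _ that] by auto
  qed
  have cont_u0: "continuous_on (UNIV - {0}) u"
    by (rule continuous_on_subset[OF cont_u]) simp
  have int_M: "integrable lborel (\<lambda>x. u x * log_radial (\<lambda>t. exp (- ?N * t) * M S t) x)" if "S > 0" for S
    by (rule integrable_mult_log_radial[where A = S]) (use that in \<open>auto intro!: continuous_intros cont_u0 cont_M M_0\<close>)

  have J_eq: "J S = (\<integral>x. u x * log_radial (\<lambda>t. exp (- ?N * t) * M S t) x \<partial>lborel)" if "S > 0" for S
    unfolding J_def Green[OF that, symmetric] \<psi>_def
  proof (intro Bochner_Integration.integral_cong refl)
    fix x
    show "u x powr p * log_radial (\<lambda>t. exp ((l - n) * t) * cutoff (k + 4) (t / S)) x =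
        laplacian (weighted_laplacian u) x * log_radial (\<lambda>t. exp (- n * t) * cutoff (k + 4) (t / S)) x"
    proof (cases "x = 0")
      case False
      have "laplacian (weighted_laplacian u) x = exp (l * ln (norm x)) * u x powr p"
        using assms(9) False by (simp add: powr_def)
      moreover have "exp ((l - n) * ln (norm x)) = exp (l * ln (norm x)) * exp (- n * ln (norm x))"
        by (simp add: mult_exp_exp algebra_simps)
      ultimately show ?thesis
        using False by (simp add: log_radial_def)
    qed simp
  qed

  obtain B where B: "\<And>x. norm x \<le> 1 \<Longrightarrow> u x \<le> B"
  proof -
    have "bounded (u ` cball 0 1)"
      by (intro compact_imp_bounded compact_continuous_image continuous_on_subset[OF cont_u]) auto
    then obtain B where "\<And>x. norm x \<le> 1 \<Longrightarrow> \<bar>u x\<bar> \<le> B"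
      by (fastforce simp: bounded_iff)
    thus thesis using that by (meson abs_le_D1)
  qed
  have B0: "0 \<le> B" using B[of 0] u_nonneg[of 0] by simp
  define D where "D = K * B + K * (2 * K) powr (1 / (p - 1))"
  have D0: "0 \<le> D" using K B0 by (simp add: D_def)

  have pointwise: "u x * M S (ln (norm x)) \<le>
      exp ((l + 2) * ln (norm x)) * u x powr p * \<psi> S (ln (norm x)) / 2 + D / S\<^sup>2" if "S \<ge> 1" "x \<noteq> 0" for S x
  proof -
    define t where "t = ln (norm x)"
    have "norm x \<le> 1" if "t \<le> 0"
      using that \<open>x \<noteq> 0\<close> by (simp add: t_def)
    moreover have "M S t \<le> K * max 0 (1 - (t / S)\<^sup>2) ^ k / S\<^sup>2"
      using M_le[OF that(1), of t] by (simp add: cutoff_def)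
    ultimately show ?thesis
      unfolding t_def[symmetric] \<psi>_def cutoff_def D_def using that(1) assms(2,3) k(2)
      by (intro absorbed_cutoff_estimate B B0 K u_nonneg) auto
  qed

  define V where "V = exp ?N * unit_ball_vol ?N"
  have V0: "0 \<le> V" by (simp add: V_def)
  have J_le: "J (real S) \<le> 6 * D * V / real S" if "S \<ge> 1" for S :: nat
  proof -
    have S: "real S > 0" "real S \<ge> 1" using that by auto
    obtain \<Phi> :: "real ^ 'n \<Rightarrow> real" where \<Phi>: "integrable lborel \<Phi>" "\<And>x. 0 \<le> \<Phi> x"
      "(\<integral>x. \<Phi> x \<partial>lborel) = (2 * real S + 1) * V"
      "\<And>x. x \<noteq> 0 \<Longrightarrow> \<bar>ln (norm x)\<bar> \<le> real S \<Longrightarrow> exp (- ?N * ln (norm x)) \<le> \<Phi> x"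
      using log_shell_majorant[where 'a = "real ^ 'n", of S] unfolding V_def by auto
    \<comment> \<open>Half of \<open>J S\<close> reappears on the right and is absorbed; it is finite.\<close>
    have "J (real S) \<le> (\<integral>x. u x powr p * log_radial (\<lambda>t. exp ((l - n) * t) * \<psi> S t) x / 2 + D / (real S)\<^sup>2 * \<Phi> x \<partial>lborel)"
      unfolding J_eq[OF S(1)]
    proof (rule integral_mono)
      show "integrable lborel (\<lambda>x. u x * log_radial (\<lambda>t. exp (- ?N * t) * M S t) x)"
        by (rule int_M[OF S(1)])
      show "integrable lborel (\<lambda>x. u x powr p * log_radial (\<lambda>t. exp ((l - n) * t) * \<psi> S t) x / 2 + D / (real S)\<^sup>2 * \<Phi> x)"
        using int_J[OF S(1)] \<Phi>(1) by simp
      show "u x * log_radial (\<lambda>t. exp (- ?N * t) * M S t) x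
          \<le> u x powr p * log_radial (\<lambda>t. exp ((l - n) * t) * \<psi> S t) x / 2 + D / (real S)\<^sup>2 * \<Phi> x" for x
      proof (cases "x = 0 \<or> \<bar>ln (norm x)\<bar> > real S")
        case True
        hence "log_radial (\<lambda>t. exp (- ?N * t) * M S t) x = 0" "log_radial (\<lambda>t. exp ((l - n) * t) * \<psi> S t) x = 0"
          using M_0 \<psi>_0 S by (auto simp: log_radial_def)
        thus ?thesis using D0 \<Phi>(2) by simp
      next
        case False
        define t where "t = ln (norm x)"
        have "exp (- ?N * t) * (u x * M S t) \<le> exp (- ?N * t) * (exp ((l + 2) * t) * u x powr p * \<psi> S t / 2 + D / (real S)\<^sup>2)"
          unfolding t_def using False S(2) by (intro mult_left_mono pointwise) auto
        also have "\<dots> = u x powr p * ((exp (- ?N * t) * exp ((l + 2) * t)) * \<psi> S t) / 2 + D / (real S)\<^sup>2 * exp (- ?N * t)"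
          by (simp add: algebra_simps)
        also have "exp (- ?N * t) * exp ((l + 2) * t) = exp ((l - n) * t)"
          by (simp add: mult_exp_exp n_def algebra_simps)
        also have "D / (real S)\<^sup>2 * exp (- ?N * t) \<le> D / (real S)\<^sup>2 * \<Phi> x"
          unfolding t_def using False D0 by (intro mult_left_mono \<Phi>(4)) auto
        finally show ?thesis
          using False by (simp add: log_radial_def t_def mult_ac)
      qed
    qed
    also have "\<dots> = J (real S) / 2 + D / (real S)\<^sup>2 * ((2 * real S + 1) * V)"
      using int_J[OF S(1)] \<Phi>(1) by (simp add: J_def \<Phi>(3))
    finally have "J (real S) \<le> 2 * (D / (real S)\<^sup>2 * ((2 * real S + 1) * V))"
      by simp
    also have "\<dots> \<le> 2 * (D / (real S)\<^sup>2 * ((3 * real S) * V))"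
      using S D0 V0 by (intro mult_left_mono mult_right_mono) auto
    also have "\<dots> = 6 * D * V / real S"
      using S by (simp add: power2_eq_square)
    finally show ?thesis .
  qed

  \<comment> \<open>Widening the cutoff increases \<open>J\<close>, so the decay of \<open>J\<close> forces it to vanish at every scale.\<close>
  have J_mono: "J r \<le> J S" if "0 < r" "r \<le> S" for r S
    unfolding J_def
  proof (rule integral_mono)
    fix x
    have "\<psi> r t \<le> \<psi> S t" for t
    proof -
      have "\<bar>t / S\<bar> \<le> \<bar>t / r\<bar>"
        unfolding abs_divide using that by (intro divide_left_mono) auto
      hence "(t / S)\<^sup>2 \<le> (t / r)\<^sup>2"
        by (rule abs_le_square_iff[THEN iffD1])
      thus ?thesis
        unfolding \<psi>_def cutoff_def by (intro power_mono) auto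
    qed
    thus "u x powr p * log_radial (\<lambda>t. exp ((l - n) * t) * \<psi> r t) x
        \<le> u x powr p * log_radial (\<lambda>t. exp ((l - n) * t) * \<psi> S t) x"
      by (intro mult_left_mono) (auto simp: log_radial_def)
  qed (use that int_J in auto)
  have J0: "J r = 0" if "r > 0" for r
  proof (rule antisym)
    show "0 \<le> J r"
      unfolding J_def
      by (intro Bochner_Integration.integral_nonneg) (auto simp: log_radial_def \<psi>_def cutoff_nonneg)
    have "eventually (\<lambda>S. J r \<le> 6 * D * V / real S) sequentially"
      using eventually_ge_at_top[of "Suc (nat \<lceil>r\<rceil>)"]
    proof eventually_elim
      case (elim S)
      hence "r \<le> real S" "S \<ge> 1" by linarith+
      thus ?case using J_mono[OF that] J_le order.trans by blast
    qed
    moreover have "(\<lambda>S. 6 * D * V / real S) \<longlonglongrightarrow> 0"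
      by (rule lim_const_over_n)
    ultimately show "J r \<le> 0"
      by (intro tendsto_lowerbound) auto
  qed

  have zero: "u x = 0" if "x \<noteq> 0" for x
  proof -
    \<comment> \<open>a scale at which \<open>x\<close> lies in the interior of the support of the cutoff\<close>
    define r where "r = \<bar>ln (norm x)\<bar> + 1"
    have r: "r > 0" by (simp add: r_def)
    let ?f = "\<lambda>x. u x powr p * log_radial (\<lambda>t. exp ((l - n) * t) * \<psi> r t) x"
    have nonneg: "0 \<le> ?f y" for y
      by (auto simp: log_radial_def \<psi>_def cutoff_nonneg)
    have "?f x = 0"
      by (rule integral_0_imp_0_of_continuous_nonneg[OF cont_J[OF r] nonneg int_J[OF r]])
         (use J0[OF r] in \<open>simp add: J_def\<close>)
    moreover have "(ln (norm x) / r)\<^sup>2 < 1"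
      by (simp add: abs_square_less_1 abs_divide r_def)
    hence "\<psi> r (ln (norm x)) > 0"
      by (simp add: \<psi>_def cutoff_def)
    ultimately show ?thesis
      using that by (simp add: log_radial_def)
  qed
  show ?thesis
  proof
    fix x
    show "u x = 0"
    proof (cases "x = 0")
      case True
      have "continuous (at 0) u" using cont_u by (simp add: continuous_on_eq_continuous_at)
      hence "(u \<longlongrightarrow> u 0) (at 0)" by (simp add: isCont_def)
      moreover have "(u \<longlongrightarrow> 0) (at 0)"
        by (rule tendsto_eventually) (auto simp: eventually_at_filter zero intro: always_eventually)
      ultimately have "u 0 = 0"
        by (rule tendsto_unique[rotated]) simp
      thus ?thesis using True by simp
    qed (rule zero)
  qed
qed

end
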